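(* Let $X$ be a complex Banach space and let $A\subseteq B(X)$ be an abelian, unital, norm closed subalgebra with spectral synthesis. If $A$ has split strict multiplicity $s.s.m.(A)=2$, then $A$ is reflexive.
   Context: $B(X)$ is the algebra of bounded linear operators on $X$; $A$ carries the operator norm. An algebra $A\subset B(X)$ has split strict multiplicity $2$, written $s.s.m.(A)=2$, if there are $x_1,x_2\in X$ such that the subspaces $X_i=\{ax_i : a\in A\}$, $i=1,2$, are closed and $X=X_1\oplus X_2$. $A$ (as an abelian unital Banach algebra) has spectral synthesis if every norm closed ideal of $A$ is the intersection of the maximal ideals of $A$ containing it. $Lat(A)$ is the set of closed subspaces of $X$ invariant under every $a\in A$, $algLat(A)=\{T\in B(X) : TK\subseteq K \text{ for every } K\in Lat(A)\}$, and $A$ is reflexive if $A=algLat(A)$. *)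

theory Defs
  imports "HOL-Analysis.Analysis" "HOL-Algebra.Ideal"
begin

class complex_normed_vector = real_normed_vector +
  fixes scaleC :: "complex \<Rightarrow> 'a \<Rightarrow> 'a"  (infixr \<open>*\<^sub>C\<close> 75)
  assumes scaleC_add_right: "c *\<^sub>C (x + y) = c *\<^sub>C x + c *\<^sub>C y"
    and scaleC_add_left: "(c + d) *\<^sub>C x = c *\<^sub>C x + d *\<^sub>C x"
    and scaleC_scaleC: "c *\<^sub>C d *\<^sub>C x = (c * d) *\<^sub>C x"
    and scaleC_of_real: "complex_of_real r *\<^sub>C x = r *\<^sub>R x"
    and norm_scaleC: "norm (c *\<^sub>C x) = cmod c * norm x"

class complex_banach = complex_normed_vector + banach

global_interpretation complex_vector:
  vector_space "scaleC :: complex \<Rightarrow> 'a \<Rightarrow> 'a :: complex_normed_vector"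
proof
  show "1 *\<^sub>C x = x" for x :: 'a
    using scaleC_of_real[of 1 x] by simp
qed (simp_all add: scaleC_add_right scaleC_add_left scaleC_scaleC)

instantiation complex :: complex_banach
begin

definition scaleC_complex :: "complex \<Rightarrow> complex \<Rightarrow> complex" where
  "scaleC_complex c x = c * x"

instance
  by standard (simp_all add: scaleC_complex_def algebra_simps norm_mult scaleR_conv_of_real)

end

lemma bounded_linear_scaleC_right:
  "bounded_linear (scaleC c :: 'a \<Rightarrow> 'a :: complex_normed_vector)"
proof (rule bounded_linear_intro[where K = "cmod c"])
  show "c *\<^sub>C r *\<^sub>R x = r *\<^sub>R c *\<^sub>C x" for r and x :: 'a
    by (simp flip: scaleC_of_real add: scaleC_scaleC mult.commute)
qed (simp_all add: scaleC_add_right norm_scaleC mult.commute)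

text \<open>
  The type of bounded real-linear operators carries the operator norm. When the codomain is a
  complex normed space, it is one too, with pointwise scaling.
\<close>

instantiation blinfun :: (real_normed_vector, complex_normed_vector) complex_normed_vector
begin

lift_definition scaleC_blinfun :: "complex \<Rightarrow> 'a \<Rightarrow>\<^sub>L 'b \<Rightarrow> 'a \<Rightarrow>\<^sub>L 'b" is "\<lambda>c f x. c *\<^sub>C f x"
  by (rule bounded_linear_compose[OF bounded_linear_scaleC_right])

instance
proof
  fix c d :: complex and r :: real and S T :: "'a \<Rightarrow>\<^sub>L 'b"
  show "c *\<^sub>C (S + T) = c *\<^sub>C S + c *\<^sub>C T"
    by transfer (simp add: scaleC_add_right)
  show "(c + d) *\<^sub>C T = c *\<^sub>C T + d *\<^sub>C T"
    by transfer (simp add: scaleC_add_left)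
  show scaleC_scaleC_T: "c *\<^sub>C d *\<^sub>C T = (c * d) *\<^sub>C T" for c d and T :: "'a \<Rightarrow>\<^sub>L 'b"
    by transfer (simp add: scaleC_scaleC)
  show scaleC_real_T: "complex_of_real r *\<^sub>C T = r *\<^sub>R T" for r and T :: "'a \<Rightarrow>\<^sub>L 'b"
    by transfer (simp add: scaleC_of_real)
  have le: "norm (c *\<^sub>C T) \<le> cmod c * norm T" for c and T :: "'a \<Rightarrow>\<^sub>L 'b"
  proof (rule norm_blinfun_bound)
    fix x
    have "norm (blinfun_apply (c *\<^sub>C T) x) = cmod c * norm (blinfun_apply T x)"
      by (simp add: scaleC_blinfun.rep_eq norm_scaleC)
    also have "\<dots> \<le> cmod c * (norm T * norm x)"
      by (intro mult_left_mono norm_blinfun) simp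
    finally show "norm (blinfun_apply (c *\<^sub>C T) x) \<le> cmod c * norm T * norm x"
      by (simp add: mult.assoc)
  qed simp
  show "norm (c *\<^sub>C T) = cmod c * norm T"
  proof (cases "c = 0")
    case True
    then show ?thesis using le[of 0 T] by simp
  next
    case False
    have "inverse c *\<^sub>C c *\<^sub>C T = T"
      using False scaleC_real_T[of 1 T] by (simp add: scaleC_scaleC_T)
    then have "norm T \<le> cmod (inverse c) * norm (c *\<^sub>C T)"
      using le[of "inverse c" "c *\<^sub>C T"] by simp
    then have "cmod c * norm T \<le> norm (c *\<^sub>C T)"
      using False by (simp add: norm_divide field_simps)
    with le[of c T] show ?thesis by simp
  qed
qed

end

instance blinfun :: (real_normed_vector, complex_banach) complex_banach ..

definition bounded_operators :: "('a::complex_normed_vector \<Rightarrow>\<^sub>L 'a) set" where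
  "bounded_operators = {T. Vector_Spaces.linear scaleC scaleC (blinfun_apply T)}"

definition unital_subalgebra :: "('a::complex_normed_vector \<Rightarrow>\<^sub>L 'a) set \<Rightarrow> bool" where
  "unital_subalgebra A \<longleftrightarrow>
     A \<subseteq> bounded_operators \<and> complex_vector.subspace A \<and>
     id_blinfun \<in> A \<and> (\<forall>S\<in>A. \<forall>T\<in>A. S o\<^sub>L T \<in> A)"

definition abelian :: "('a::complex_normed_vector \<Rightarrow>\<^sub>L 'a) set \<Rightarrow> bool" where
  "abelian A \<longleftrightarrow> (\<forall>S\<in>A. \<forall>T\<in>A. S o\<^sub>L T = T o\<^sub>L S)"

definition operator_ring :: "('a::complex_normed_vector \<Rightarrow>\<^sub>L 'a) set \<Rightarrow> ('a \<Rightarrow>\<^sub>L 'a) ring" where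
  "operator_ring A = \<lparr>carrier = A, mult = (o\<^sub>L), one = id_blinfun, zero = 0, add = (+)\<rparr>"

lemma ring_operator_ring:
  assumes "unital_subalgebra A"
  shows "ring (operator_ring A)"
proof -
  note A = assms[unfolded unital_subalgebra_def]
  have neg: "- T \<in> A" if "T \<in> A" for T
    using A that complex_vector.subspace_neg by blast
  show ?thesis
  proof (rule ringI)
    show "abelian_group (operator_ring A)"
      using A neg
      by (intro abelian_groupI)
        (auto simp: operator_ring_def complex_vector.subspace_add complex_vector.subspace_0
          intro!: bexI[of _ "- _"])
    show "monoid (operator_ring A)"
      using A by (intro monoidI) (auto simp: operator_ring_def intro!: blinfun_eqI)
  qed (auto simp: operator_ring_def blinfun.bilinear_simps intro!: blinfun_eqI)
qed

text \<open>
  A ring ideal of a unital subalgebra is automatically closed under complex scaling, so the ring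
  ideals of \<^term>\<open>operator_ring A\<close> are exactly the algebra ideals of \<^term>\<open>A\<close>.
\<close>

lemma ideal_operator_ring_subspace:
  assumes "unital_subalgebra A" and J: "ideal J (operator_ring A)"
  shows "complex_vector.subspace J"
proof -
  interpret ideal J "operator_ring A" by (fact J)
  note A = assms(1)[unfolded unital_subalgebra_def]
  have "c *\<^sub>C T \<in> J" if "T \<in> J" for c T
  proof -
    have "c *\<^sub>C id_blinfun \<in> A"
      using A complex_vector.subspace_scale by blast
    then have "(c *\<^sub>C id_blinfun) o\<^sub>L T \<in> J"
      using I_l_closed[OF that] by (simp add: operator_ring_def)
    moreover have "(c *\<^sub>C id_blinfun) o\<^sub>L T = c *\<^sub>C T"
      by (rule blinfun_eqI) (simp add: scaleC_blinfun.rep_eq)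
    ultimately show ?thesis by simp
  qed
  moreover have "0 \<in> J" "\<And>S T. S \<in> J \<Longrightarrow> T \<in> J \<Longrightarrow> S + T \<in> J"
    using additive_subgroup.zero_closed[OF is_additive_subgroup]
      additive_subgroup.a_closed[OF is_additive_subgroup]
    by (simp_all add: operator_ring_def)
  ultimately show ?thesis
    by (simp add: complex_vector.subspace_def)
qed

text \<open>
  The intersection is taken inside \<^term>\<open>A\<close>: for the improper ideal the family of maximal ideals
  is empty and its intersection is \<^term>\<open>A\<close> itself.
\<close>

definition spectral_synthesis :: "('a::complex_normed_vector \<Rightarrow>\<^sub>L 'a) set \<Rightarrow> bool" where
  "spectral_synthesis A \<longleftrightarrow>
     (\<forall>J. ideal J (operator_ring A) \<and> closed J \<longrightarrow>
        J = A \<inter> \<Inter>{M. maximalideal M (operator_ring A) \<and> J \<subseteq> M})"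

definition orbit :: "('a::complex_normed_vector \<Rightarrow>\<^sub>L 'a) set \<Rightarrow> 'a \<Rightarrow> 'a set" where
  "orbit A x = {blinfun_apply T x | T. T \<in> A}"

definition direct_sum_decomposition :: "'a::complex_normed_vector set \<Rightarrow> 'a set \<Rightarrow> bool" where
  "direct_sum_decomposition U V \<longleftrightarrow> U \<inter> V = {0} \<and> {u + v | u v. u \<in> U \<and> v \<in> V} = UNIV"

definition split_strict_multiplicity_two :: "('a::complex_normed_vector \<Rightarrow>\<^sub>L 'a) set \<Rightarrow> bool" where
  "split_strict_multiplicity_two A \<longleftrightarrow>
     (\<exists>x\<^sub>1 x\<^sub>2. closed (orbit A x\<^sub>1) \<and> closed (orbit A x\<^sub>2) \<and>
        direct_sum_decomposition (orbit A x\<^sub>1) (orbit A x\<^sub>2))"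

definition Lat :: "('a::complex_normed_vector \<Rightarrow>\<^sub>L 'a) set \<Rightarrow> 'a set set" where
  "Lat A = {K. complex_vector.subspace K \<and> closed K \<and> (\<forall>T\<in>A. blinfun_apply T ` K \<subseteq> K)}"

definition algLat :: "('a::complex_normed_vector \<Rightarrow>\<^sub>L 'a) set \<Rightarrow> ('a \<Rightarrow>\<^sub>L 'a) set" where
  "algLat A = {T \<in> bounded_operators. \<forall>K\<in>Lat A. blinfun_apply T ` K \<subseteq> K}"

definition reflexive :: "('a::complex_normed_vector \<Rightarrow>\<^sub>L 'a) set \<Rightarrow> bool" where
  "reflexive A \<longleftrightarrow> A = algLat A"

end

theory Submission
  imports Defs
begin

text \<open>
  Let \<open>X = A x \<oplus> A y\<close>. By the open mapping theorem, \<open>T\<close> in \<open>A\<close> is bounded by \<open>T (x + y)\<close>, so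
  \<open>A (x + y)\<close> is a closed invariant subspace. Hence for \<open>T\<close> in \<open>algLat A\<close> there is \<open>a\<close> in \<open>A\<close>
  with \<open>T (x + y) = a (x + y)\<close>, and directness of the sum gives \<open>T x = a x\<close> and \<open>T y = a y\<close>.
  It remains to see that \<open>S = T - a\<close>, which kills \<open>x\<close>, kills \<open>A x\<close>. If \<open>M\<close> is a maximal
  ideal containing the annihilator of \<open>x\<close>, then \<open>M x\<close> is a closed invariant subspace that, by
  the Gelfand--Mazur theorem, spans \<open>A x\<close> together with \<open>x\<close>; so \<open>S\<close> maps \<open>A x\<close> into \<open>M x\<close>.
  By spectral synthesis the annihilator is the intersection of these \<open>M\<close>, so the intersection of
  the \<open>M x\<close> is \<open>0\<close>.
\<close>

section \<open>The open mapping theorem\<close>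

text \<open>Baire's theorem gives approximate preimages of controlled norm, and successive
  approximation makes them exact. The domain is a closed subspace \<open>E\<close> of a Banach space
  because the lemma is applied to \<open>A \<times> A\<close>, which is a set and not a
  type.\<close>

lemma bounded_linear_surj_bounded_preimage:
  fixes f :: "'b::banach \<Rightarrow> 'c::banach"
  assumes f: "bounded_linear f" and E: "subspace E" "closed E" and surj: "f ` E = UNIV"
  obtains C where "C > 0" "\<And>y. \<exists>x\<in>E. f x = y \<and> norm x \<le> C * norm y"
proof -
  interpret f: bounded_linear f by fact
  \<comment> \<open>Baire's theorem needs closed sets, hence the closures; they cover the codomain
    because \<open>f\<close> maps \<open>E\<close> onto it.\<close>
  define T where "T n = closure (f ` (E \<inter> cball 0 (real n)))" for n
  have cover: "\<Union>(range T) = UNIV"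
  proof -
    have "\<exists>n. y \<in> T n" for y
    proof -
      obtain x where "x \<in> E" "f x = y"
        using surj by (metis UNIV_I imageE)
      moreover obtain n where "norm x \<le> real n"
        using real_arch_simple by blast
      ultimately have "y \<in> f ` (E \<inter> cball 0 (real n))"
        by auto
      then show ?thesis
        unfolding T_def by (meson closure_subset subsetD)
    qed
    then show ?thesis by blast
  qed
  have "\<exists>n. interior (T n) \<noteq> {}"
  proof (rule ccontr)
    assume "\<not> ?thesis"
    then have "euclidean interior_of \<Union>(range T) = {}"
      by (intro Baire_category_alt) (auto simp: T_def completely_metrizable_space_euclidean)
    then show False
      by (simp add: cover)
  qed
  then obtain n y r where r: "r > 0" "ball y r \<subseteq> T n"
    by (metis ex_in_conv mem_interior)
  \<comment> \<open>Recentring at 0: \<open>z\<close> is half the difference of \<open>y + z\<close>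
    and \<open>y - z\<close>, both in the ball around \<open>y\<close>, so half the difference of
    their approximate preimages works, still with norm at most \<open>n\<close>.\<close>
  have ball_approx: "\<exists>x\<in>E. norm x \<le> n \<and> norm (z - f x) < d" if "norm z < r" "d > 0" for z d
  proof -
    have "y + z \<in> T n" "y - z \<in> T n"
      using r that by (auto simp: dist_norm subset_iff)
    then obtain a b where a: "a \<in> E" "norm a \<le> n" "norm (f a - (y + z)) < d"
      and b: "b \<in> E" "norm b \<le> n" "norm (f b - (y - z)) < d"
      using \<open>d > 0\<close> by (fastforce simp: T_def closure_approachable dist_norm)
    let ?x = "(1/2) *\<^sub>R (a - b)"
    have eq: "z - f ?x = (1/2) *\<^sub>R ((f b - (y - z)) - (f a - (y + z)))"
      by (simp add: f.scaleR f.diff algebra_simps flip: scaleR_left.add)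
    have "norm (z - f ?x) \<le> (1/2) * (norm (f b - (y - z)) + norm (f a - (y + z)))"
      unfolding eq norm_scaleR by (intro mult_mono norm_triangle_ineq4) auto
    moreover have "norm ?x \<le> (1/2) * (norm a + norm b)"
      by (simp add: norm_triangle_ineq4)
    moreover have "?x \<in> E"
      using a b E by (simp add: subspace_diff subspace_scale)
    ultimately show ?thesis
      using a b by (intro bexI[of _ ?x]) auto
  qed
  define K where "K = 2 * n / r"
  have "\<exists>x\<in>E. norm x \<le> K * norm z \<and> norm (z - f x) \<le> norm z / 2" for z
  proof (cases "z = 0")
    case True
    then show ?thesis using E by (auto simp: subspace_0 f.zero intro!: bexI[of _ 0])
  next
    case False
    \<comment> \<open>The factor \<open>s\<close> scales \<open>z\<close> to norm
      \<open>r / 2\<close>; undoing the scaling turns the bound \<open>n\<close> into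
      \<open>K * norm z\<close> and the chosen error into \<open>norm z / 2\<close>.\<close>
    define s where "s = r / (2 * norm z)"
    have s: "s > 0" using False r by (simp add: s_def)
    have "norm (s *\<^sub>R z) < r" "s * norm z / 2 > 0"
      using False r by (simp_all add: s_def)
    then obtain x where x: "x \<in> E" "norm x \<le> n" "norm (s *\<^sub>R z - f x) < s * norm z / 2"
      using ball_approx by blast
    let ?x = "(1/s) *\<^sub>R x"
    have "z - f ?x = (1/s) *\<^sub>R (s *\<^sub>R z - f x)"
      using s by (simp add: f.scaleR scaleR_diff_right)
    then have "norm (z - f ?x) = norm (s *\<^sub>R z - f x) / s"
      using s by simp
    also have "\<dots> \<le> norm z / 2"
      using x(3) s by (simp add: field_simps)
    finally have "norm (z - f ?x) \<le> norm z / 2" .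
    moreover have "norm ?x \<le> K * norm z"
      using x(2) s False r by (simp add: K_def s_def field_simps)
    ultimately show ?thesis
      using x(1) E by (intro bexI[of _ ?x]) (auto simp: subspace_scale)
  qed
  then obtain g where g: "\<And>z. g z \<in> E" "\<And>z. norm (g z) \<le> K * norm z"
    "\<And>z. norm (z - f (g z)) \<le> norm z / 2"
    by metis
  have K: "K \<ge> 0" using r by (simp add: K_def)
  \<comment> \<open>Summing the geometric series gives \<open>2 * K\<close>; the extra 1 makes the
    constant strictly positive.\<close>
  have "\<exists>x\<in>E. f x = y \<and> norm x \<le> (2 * K + 1) * norm y" for y
  proof -
    \<comment> \<open>\<open>z k\<close> is the residual after \<open>k\<close> corrections; each
      correction at least halves its norm.\<close>
    define z where "z k = ((\<lambda>z. z - f (g z)) ^^ k) y" for k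
    have z_Suc: "z (Suc k) = z k - f (g (z k))" for k
      by (simp add: z_def)
    have z_le: "norm (z k) \<le> norm y * (1/2)^k" for k
    proof (induction k)
      case (Suc k)
      then show ?case using g(3)[of "z k"] by (simp add: z_Suc)
    qed (simp add: z_def)
    have g_le: "norm (g (z k)) \<le> K * norm y * (1/2)^k" for k
      using g(2)[of "z k"] mult_left_mono[OF z_le[of k] K] by (simp add: mult.assoc)
    have geo: "(\<lambda>k. K * norm y * (1/2)^k) sums (K * norm y * 2)"
      using geometric_sums[of "1/2::real"] by (intro sums_mult) simp
    have summ: "summable (\<lambda>k. g (z k))"
      by (rule summable_comparison_test'[OF sums_summable[OF geo]]) (use g_le in auto)
    define x where "x = (\<Sum>k. g (z k))"
    have "(\<lambda>k. g (z k)) sums x"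
      using summ by (simp add: x_def summable_sums)
    then have lim: "(\<lambda>m. \<Sum>k<m. g (z k)) \<longlonglongrightarrow> x"
      by (simp add: sums_def)
    then have "x \<in> E"
      using E g(1) by (intro Lim_in_closed_set[OF E(2) _ _ lim]) (auto simp: subspace_sum)
    moreover have "f x = y"
    proof -
      have "f (\<Sum>k<m. g (z k)) = y - z m" for m
        by (induction m) (simp_all add: f.zero f.add z_Suc, simp add: z_def)
      moreover have "z \<longlonglongrightarrow> 0"
      proof (rule tendsto_norm_zero_cancel, rule tendsto_sandwich[of "\<lambda>_. 0"])
        show "(\<lambda>k. norm y * (1/2)^k) \<longlonglongrightarrow> 0"
          by (intro tendsto_mult_right_zero LIMSEQ_realpow_zero) auto
      qed (use z_le in auto)
      ultimately have "(\<lambda>m. f (\<Sum>k<m. g (z k))) \<longlonglongrightarrow> y - 0"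
        by (simp only:) (intro tendsto_intros)
      then show ?thesis
        using f.tendsto[OF lim] LIMSEQ_unique by fastforce
    qed
    moreover have "norm x \<le> (2 * K + 1) * norm y"
    proof -
      have "norm x \<le> (\<Sum>k. K * norm y * (1/2)^k)"
        unfolding x_def using geo g_le by (intro norm_suminf_le) (auto simp: sums_iff)
      also have "\<dots> = K * norm y * 2"
        using geo by (rule sums_unique[symmetric])
      also have "\<dots> \<le> (2 * K + 1) * norm y"
        by (simp add: distrib_right)
      finally show ?thesis .
    qed
    ultimately show ?thesis by blast
  qed
  with K show ?thesis
    by (intro that[of "2 * K + 1"]) auto
qed

section \<open>The quotient norm and a maximum principle\<close>

text \<open>Maximum principle: for \<open>\<epsilon> > 0\<close> the four-point mean of \<open>|z|\<^sup>2\<close> exceeds its central value by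
  \<open>h\<^sup>2\<close>, which beats the error \<open>K h\<^sup>3\<close>, so \<open>v z + \<epsilon> |z|\<^sup>2\<close> has no maximum inside a disc.\<close>

lemma submean_vanishing_at_infinity_nonpos:
  fixes v :: "complex \<Rightarrow> real"
  assumes cont: "continuous_on UNIV v"
    and mean: "\<And>z. \<exists>K. \<forall>\<^sub>F h in at_right 0.
      4 * v z \<le> v (z + of_real h) + v (z - of_real h) + v (z + \<i> * of_real h) + v (z - \<i> * of_real h) + K * h ^ 3"
    and lim: "(v \<longlongrightarrow> 0) at_infinity"
  shows "v z \<le> 0"
proof (rule ccontr)
  assume "\<not> v z \<le> 0"
  then have pos: "v z > 0" by simp
  have "\<forall>\<^sub>F w in at_infinity. v w < v z / 2"
    using order_tendstoD(2)[OF lim, of "v z / 2"] pos by simp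
  then obtain R0 where R0: "\<And>w. norm w \<ge> R0 \<Longrightarrow> v w < v z / 2"
    by (auto simp: eventually_at_infinity)
  define R where "R = max (norm z) R0 + 1"
  have R: "R > norm z" "R > R0" "R > 0"
    by (auto simp: R_def max_def) (smt (verit) norm_ge_zero)+
  \<comment> \<open>With this \<open>e\<close> the quadratic term equals \<open>v z / 2\<close> on
    the circle of radius \<open>R\<close>, where also \<open>v < v z / 2\<close>. So
    \<open>u\<close> is below \<open>v z\<close> there, and its maximum over the disc is attained in
    the interior.\<close>
  define e where "e = v z / (2 * R\<^sup>2)"
  have e: "e > 0" "e * R\<^sup>2 = v z / 2"
    using R pos by (simp_all add: e_def)
  define u where "u w = v w + e * (norm w)\<^sup>2" for w
  have "continuous_on (cball 0 R) u"
    unfolding u_def by (intro continuous_intros continuous_on_subset[OF cont]) auto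
  moreover have "compact (cball (0::complex) R)" "cball (0::complex) R \<noteq> {}"
    using R by auto
  ultimately obtain w where w: "norm w \<le> R" "\<And>y. norm y \<le> R \<Longrightarrow> u y \<le> u w"
    using continuous_attains_sup[of "cball (0::complex) R" u] by auto
  have uz: "v z \<le> u w"
    using w(2)[of z] R e by (simp add: u_def) (smt (verit) mult_nonneg_nonneg zero_le_power2)
  have "norm w < R"
  proof (rule ccontr)
    assume "\<not> norm w < R"
    then have "norm w = R" using w by simp
    then have "u w < v z / 2 + e * R\<^sup>2"
      using R0[of w] R by (simp add: u_def)
    then show False using uz e by simp
  qed
  obtain K where K: "\<forall>\<^sub>F h in at_right 0.
      4 * v w \<le> v (w + of_real h) + v (w - of_real h) + v (w + \<i> * of_real h) + v (w - \<i> * of_real h) + K * h ^ 3"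
    using mean by blast
  have "((\<lambda>h. K * h) \<longlongrightarrow> K * 0) (at_right 0)"
    by (intro tendsto_intros)
  then have "\<forall>\<^sub>F h in at_right 0. K * h < 4 * e"
    using e by (intro order_tendstoD(2)) auto
  moreover have "\<forall>\<^sub>F h in at_right 0. h < R - norm w"
    using \<open>norm w < R\<close> by (intro eventually_at_right_real[THEN eventually_mono]) auto
  moreover have "\<forall>\<^sub>F h in at_right (0::real). h > 0"
    by (simp add: eventually_at_right_less)
  ultimately have "\<forall>\<^sub>F h in at_right (0::real). False"
    using K
  proof eventually_elim
    case (elim h)
    \<comment> \<open>The bound \<open>h < R - norm w\<close> keeps the neighbours of
      \<open>w\<close> at distance \<open>h\<close> inside the disc.\<close>
    have le: "u y \<le> u w" if "norm (y - w) = h" for y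
      using that elim norm_triangle_ineq2[of y w] by (intro w(2)) simp
    have "u (w + of_real h) + u (w - of_real h) + u (w + \<i> * of_real h) + u (w - \<i> * of_real h) \<le> 4 * u w"
      using le[of "w + of_real h"] le[of "w - of_real h"] le[of "w + \<i> * of_real h"]
        le[of "w - \<i> * of_real h"] elim by (simp add: norm_mult)
    moreover have "(norm (w + of_real h))\<^sup>2 + (norm (w - of_real h))\<^sup>2 + (norm (w + \<i> * of_real h))\<^sup>2
        + (norm (w - \<i> * of_real h))\<^sup>2 = 4 * (norm w)\<^sup>2 + 4 * h\<^sup>2"
      by (simp add: cmod_power2) (simp add: power2_eq_square algebra_simps)
    then have "e * (norm (w + of_real h))\<^sup>2 + e * (norm (w - of_real h))\<^sup>2 + e * (norm (w + \<i> * of_real h))\<^sup>2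
        + e * (norm (w - \<i> * of_real h))\<^sup>2 = 4 * (e * (norm w)\<^sup>2) + 4 * e * h\<^sup>2"
      by (metis (no_types, lifting) distrib_left mult.assoc mult.left_commute)
    ultimately have "4 * e * h\<^sup>2 \<le> K * h ^ 3"
      using elim by (simp add: u_def)
    moreover have "K * h ^ 3 < 4 * e * h\<^sup>2"
      using elim mult_strict_right_mono[of "K * h" "4 * e" "h\<^sup>2"]
      by (simp add: power3_eq_cube power2_eq_square mult.assoc)
    ultimately show False by simp
  qed
  then show False
    by (simp add: eventually_False)
qed

section \<open>Distance to a subspace as a quotient seminorm\<close>

lemma infdist_approx:
  assumes "M \<noteq> {}" "d > 0"
  obtains m where "m \<in> M" "dist x m < infdist x M + d"
proof -
  have "\<exists>m\<in>M. dist x m < infdist x M + d"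
    using assms cINF_less_iff[of M "dist x" "infdist x M + d"]
    by (auto simp: infdist_notempty intro!: bdd_belowI[of _ 0])
  then show ?thesis using that by blast
qed

text \<open>Near-optimal elements of \<open>M\<close> for \<open>x\<close> are carried by
  \<open>f\<close> to competitors for \<open>f x\<close>. Used for scaling and for multiplication by
  an element of \<open>A\<close>.\<close>

lemma infdist_lipschitz_image_le:
  assumes K: "\<And>x y. dist (f x) (f y) \<le> K * dist x y" "K \<ge> 0"
    and f: "f ` M \<subseteq> M" and "M \<noteq> {}"
  shows "infdist (f x) M \<le> K * infdist x M"
proof (rule field_le_epsilon)
  fix d :: real assume "d > 0"
  \<comment> \<open>The \<open>+ 1\<close> keeps the tolerance positive when
    \<open>K = 0\<close>.\<close>
  then obtain m where m: "m \<in> M" "dist x m < infdist x M + d / (K + 1)"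
    using infdist_approx[of M "d / (K + 1)" x] assms by auto
  have "infdist (f x) M \<le> dist (f x) (f m)"
    using m f by (intro infdist_le) auto
  also have "\<dots> \<le> K * dist x m"
    by (rule K)
  also have "\<dots> \<le> K * (infdist x M + d / (K + 1))"
    using m K by (intro mult_left_mono) auto
  also have "\<dots> \<le> K * infdist x M + d"
    using K \<open>d > 0\<close> by (simp add: field_simps)
  finally show "infdist (f x) M \<le> K * infdist x M + d" .
qed

context
  fixes M :: "'b::complex_normed_vector set"
  assumes M: "complex_vector.subspace M"
begin

lemma infdist_subspace_add_le: "infdist (x + y) M \<le> infdist x M + infdist y M"
proof (rule field_le_epsilon)
  fix d :: real assume d: "d > 0"
  have ne: "M \<noteq> {}"
    using complex_vector.subspace_0[OF M] by auto
  obtain m n where "m \<in> M" "dist x m < infdist x M + d/2" "n \<in> M" "dist y n < infdist y M + d/2"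
    using infdist_approx[OF ne, of "d/2"] d by (metis half_gt_zero)
  moreover from this have "infdist (x + y) M \<le> dist (x + y) (m + n)"
    using M by (intro infdist_le) (simp add: complex_vector.subspace_add)
  moreover have "dist (x + y) (m + n) \<le> dist x m + dist y n"
    by (rule dist_triangle_add)
  ultimately show "infdist (x + y) M \<le> infdist x M + infdist y M + d"
    by linarith
qed

text \<open>Elements of \<open>M\<close> have distance 0, so subadditivity used in both directions
  makes the distance constant on cosets.\<close>

lemma infdist_subspace_cong:
  assumes "x - y \<in> M"
  shows "infdist x M = infdist y M"
proof -
  have "y - x \<in> M"
    using complex_vector.subspace_neg[OF M assms] by simp
  then show ?thesis
    using assms infdist_subspace_add_le[of y "x - y"] infdist_subspace_add_le[of x "y - x"]
    by (simp add: complex_vector.subspace_0)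
qed

lemma infdist_subspace_scaleC: "infdist (c *\<^sub>C x) M = cmod c * infdist x M"
proof -
  have le: "infdist (c *\<^sub>C x) M \<le> cmod c * infdist x M" for c x
  proof (rule infdist_lipschitz_image_le)
    show "dist (c *\<^sub>C x) (c *\<^sub>C y) \<le> cmod c * dist x y" for x y :: 'b
      by (simp add: dist_norm norm_scaleC flip: complex_vector.scale_right_diff_distrib)
  qed (use M in \<open>auto simp: complex_vector.subspace_scale dest: complex_vector.subspace_0\<close>)
  show ?thesis
  proof (cases "c = 0")
    case True
    then show ?thesis using M by (simp add: complex_vector.subspace_0)
  next
    case False
    then have "infdist x M \<le> cmod (inverse c) * infdist (c *\<^sub>C x) M"
      using le[of "inverse c" "c *\<^sub>C x"] by simp
    with False have "cmod c * infdist x M \<le> infdist (c *\<^sub>C x) M"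
      by (simp add: norm_divide field_simps)
    with le[of c x] show ?thesis by simp
  qed
qed

end

section \<open>Ideals of abelian operator algebras\<close>

lemma blinfun_compose_id_right: "T o\<^sub>L id_blinfun = T"
  by (rule blinfun_eqI) simp

locale abelian_operator_algebra =
  fixes A :: "('a::complex_banach \<Rightarrow>\<^sub>L 'a) set"
  assumes unital: "unital_subalgebra A" and abelian: "abelian A" and closed: "closed A"
begin

lemma subspace: "complex_vector.subspace A"
  using unital by (simp add: unital_subalgebra_def)

lemma id_mem: "id_blinfun \<in> A"
  using unital by (simp add: unital_subalgebra_def)

lemma comp_mem: "S \<in> A \<Longrightarrow> T \<in> A \<Longrightarrow> S o\<^sub>L T \<in> A"
  using unital by (simp add: unital_subalgebra_def)

lemmas diff_mem = complex_vector.subspace_diff[OF subspace]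
  and add_mem = complex_vector.subspace_add[OF subspace]
  and scale_mem = complex_vector.subspace_scale[OF subspace]

lemma comp_commute: "S \<in> A \<Longrightarrow> T \<in> A \<Longrightarrow> S o\<^sub>L T = T o\<^sub>L S"
  using abelian by (simp add: abelian_def)

lemma apply_commute: "S \<in> A \<Longrightarrow> T \<in> A \<Longrightarrow> S (T x) = T (S x)"
  using comp_commute[of S T] by (metis blinfun_apply_blinfun_compose)

lemma apply_scaleC: "T \<in> A \<Longrightarrow> T (c *\<^sub>C x) = c *\<^sub>C T x"
  using unital
  by (auto simp: unital_subalgebra_def bounded_operators_def Vector_Spaces.linear_iff)

text \<open>Replaces the ring-theoretic notion by linear algebra; commutativity of \<open>A\<close>
  makes left ideals two-sided.\<close>

lemma ideal_iff:
  "ideal J (operator_ring A) \<longleftrightarrow>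
    J \<subseteq> A \<and> complex_vector.subspace J \<and> (\<forall>S\<in>A. \<forall>T\<in>J. S o\<^sub>L T \<in> J)"
proof (intro iffI conjI)
  assume J: "ideal J (operator_ring A)"
  interpret ideal J "operator_ring A" by fact
  show "J \<subseteq> A"
    using a_subset by (simp add: operator_ring_def)
  show "complex_vector.subspace J"
    using unital J by (rule ideal_operator_ring_subspace)
  show "\<forall>S\<in>A. \<forall>T\<in>J. S o\<^sub>L T \<in> J"
    using I_l_closed by (simp add: operator_ring_def)
next
  interpret R: ring "operator_ring A"
    using unital by (rule ring_operator_ring)
  assume "J \<subseteq> A \<and> complex_vector.subspace J \<and> (\<forall>S\<in>A. \<forall>T\<in>J. S o\<^sub>L T \<in> J)"
  then have J: "J \<subseteq> A" "complex_vector.subspace J" "\<And>S T. S \<in> A \<Longrightarrow> T \<in> J \<Longrightarrow> S o\<^sub>L T \<in> J"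
    by auto
  show "ideal J (operator_ring A)"
  proof (rule idealI)
    show "ring (operator_ring A)" ..
    show "subgroup J (add_monoid (operator_ring A))"
    proof (rule group.subgroupI)
      show "group (add_monoid (operator_ring A))"
        by (rule R.a_group)
      fix S assume S: "S \<in> J"
      have neg: "- S \<in> J"
        using J(2) S by (rule complex_vector.subspace_neg)
      have "inv\<^bsub>add_monoid (operator_ring A)\<^esub> S = - S"
        using R.a_group
        by (rule group.inv_equality) (use J(1) S neg in \<open>auto simp: operator_ring_def\<close>)
      with neg show "inv\<^bsub>add_monoid (operator_ring A)\<^esub> S \<in> J"
        by simp
    qed (use J complex_vector.subspace_0[OF J(2)] in
        \<open>auto simp: operator_ring_def complex_vector.subspace_add\<close>)
    fix S T
    assume "S \<in> J" "T \<in> carrier (operator_ring A)"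
    then show "T \<otimes>\<^bsub>operator_ring A\<^esub> S \<in> J" "S \<otimes>\<^bsub>operator_ring A\<^esub> T \<in> J"
      using J comp_commute[of S T] by (auto simp: operator_ring_def)
  qed
qed

text \<open>Gelfand--Mazur without Hahn--Banach and without forming the quotient: \<open>infdist _ M\<close> is the
  quotient norm, and the norm of the resolvent modulo \<open>M\<close> satisfies the hypotheses of
  \<open>submean_vanishing_at_infinity_nonpos\<close>.\<close>

lemma exists_not_invertible_mod_ideal:
  assumes J: "ideal M (operator_ring A)" and "closed M" and "id_blinfun \<notin> M" and b: "b \<in> A"
  shows "\<exists>z. \<forall>c\<in>A. ((z *\<^sub>C id_blinfun - b) o\<^sub>L c) - id_blinfun \<notin> M"
proof (rule ccontr)
  assume "\<not> ?thesis"
  then obtain c where c: "\<And>z. c z \<in> A"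
    and inv: "\<And>z. ((z *\<^sub>C id_blinfun - b) o\<^sub>L c z) - id_blinfun \<in> M"
    by metis
  have M: "M \<subseteq> A" "complex_vector.subspace M" "\<And>S T. S \<in> A \<Longrightarrow> T \<in> M \<Longrightarrow> S o\<^sub>L T \<in> M"
    using J by (simp_all add: ideal_iff)
  have ne: "M \<noteq> {}"
    using complex_vector.subspace_0[OF M(2)] by blast
  define q where "q T = infdist T M" for T
  have q_nonneg: "q T \<ge> 0" for T
    by (simp add: q_def infdist_nonneg)
  have q_add: "q (S + T) \<le> q S + q T" for S T
    unfolding q_def using M(2) by (rule infdist_subspace_add_le)
  have q_cong: "S - T \<in> M \<Longrightarrow> q S = q T" for S T
    unfolding q_def using M(2) by (rule infdist_subspace_cong)
  have q_scale: "q (z *\<^sub>C T) = cmod z * q T" for z T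
    unfolding q_def using M(2) by (rule infdist_subspace_scaleC)
  have q_comp: "q (S o\<^sub>L T) \<le> norm S * q T" if "S \<in> A" for S T
    unfolding q_def
  proof (rule infdist_lipschitz_image_le)
    show "dist (S o\<^sub>L T) (S o\<^sub>L T') \<le> norm S * dist T T'" for T T' :: "'a \<Rightarrow>\<^sub>L 'a"
      using norm_blinfun_compose[of S "T - T'"]
      by (simp add: dist_norm bounded_bilinear.diff_right[OF bounded_bilinear_blinfun_compose])
  qed (use that ne M in auto)
  \<comment> \<open>The resolvent identity modulo \<open>M\<close>. The difference is written as
    \<open>s\<close> times the defect of \<open>t\<close> minus \<open>t\<close> times the defect of
    \<open>s\<close>, where both defects lie in \<open>M\<close>.\<close>
  have step: "c (z + w) - (c z + (- w) *\<^sub>C (c z o\<^sub>L c (z + w))) \<in> M" for z w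
  proof -
    define s t where "s = c z" and "t = c (z + w)"
    have st: "s \<in> A" "t \<in> A"
      by (simp_all add: s_def t_def c)
    have comm: "t (s x) = s (t x)" "s (b x) = b (s x)" "t (b x) = b (t x)" for x
      using apply_commute st b by auto
    have "t - (s + (- w) *\<^sub>C (s o\<^sub>L t)) =
        (s o\<^sub>L ((((z + w) *\<^sub>C id_blinfun - b) o\<^sub>L t) - id_blinfun))
        - (t o\<^sub>L (((z *\<^sub>C id_blinfun - b) o\<^sub>L s) - id_blinfun))"
      by (rule blinfun_eqI)
        (simp add: blinfun.bilinear_simps scaleC_blinfun.rep_eq apply_scaleC st comm scaleC_add_left)
    then show ?thesis
      unfolding s_def t_def using M c inv by (simp add: complex_vector.subspace_diff)
  qed
  define v where "v z = q (c z)" for z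
  have v_step: "v (z + w) \<le> v z + cmod w * norm (c z) * v (z + w)" for z w
  proof -
    have "v (z + w) = q (c z + (- w) *\<^sub>C (c z o\<^sub>L c (z + w)))"
      unfolding v_def by (rule q_cong[OF step])
    also have "\<dots> \<le> q (c z) + cmod w * q (c z o\<^sub>L c (z + w))"
      using q_add[of "c z" "(- w) *\<^sub>C (c z o\<^sub>L c (z + w))"] q_scale[of "- w"] by simp
    also have "\<dots> \<le> v z + cmod w * (norm (c z) * v (z + w))"
      unfolding v_def by (intro add_left_mono mult_left_mono q_comp c) auto
    finally show ?thesis by (simp add: mult.assoc)
  qed
  \<comment> \<open>For small \<open>w\<close> the last term of \<open>v_step\<close> is at most
    half of \<open>v (z + w)\<close> and can be absorbed on the left.\<close>
  have v_local: "v (z + w) \<le> 2 * v z" if "cmod w * norm (c z) \<le> 1/2" for z w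
    using v_step[of z w] mult_right_mono[OF that, of "v (z + w)"] q_nonneg by (simp add: v_def)
  have v_step': "v z \<le> v (z + w) + cmod w * norm (c z) * v (z + w)" for z w
  proof -
    have "c z - (c (z + w) + w *\<^sub>C (c z o\<^sub>L c (z + w))) \<in> M"
      using complex_vector.subspace_neg[OF M(2) step[of z w]] by (simp add: algebra_simps)
    then have "v z = q (c (z + w) + w *\<^sub>C (c z o\<^sub>L c (z + w)))"
      unfolding v_def by (rule q_cong)
    also have "\<dots> \<le> q (c (z + w)) + cmod w * q (c z o\<^sub>L c (z + w))"
      using q_add[of "c (z + w)" "w *\<^sub>C (c z o\<^sub>L c (z + w))"] q_scale[of w] by simp
    also have "\<dots> \<le> v (z + w) + cmod w * (norm (c z) * v (z + w))"
      unfolding v_def by (intro add_left_mono mult_left_mono q_comp c) auto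
    finally show ?thesis by (simp add: mult.assoc)
  qed
  have near: "\<forall>\<^sub>F h in nhds 0. cmod h * norm (c z) < 1/2" for z
  proof -
    have "((\<lambda>h. cmod h * norm (c z)) \<longlongrightarrow> cmod 0 * norm (c z)) (nhds 0)"
      by (intro tendsto_intros filterlim_ident)
    then show ?thesis by (intro order_tendstoD(2)) auto
  qed
  have "isCont v z" for z
  proof -
    have "((\<lambda>w. v (z + w) - v z) \<longlongrightarrow> 0) (nhds 0)"
    proof (rule Lim_null_comparison)
      show "((\<lambda>w. cmod w * norm (c z) * (2 * v z)) \<longlongrightarrow> 0) (nhds 0)"
        by (auto intro!: tendsto_eq_intros filterlim_ident)
      show "\<forall>\<^sub>F w in nhds 0. norm (v (z + w) - v z) \<le> cmod w * norm (c z) * (2 * v z)"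
        using near[of z]
      proof eventually_elim
        case (elim w)
        then have "cmod w * norm (c z) * v (z + w) \<le> cmod w * norm (c z) * (2 * v z)"
          by (intro mult_left_mono v_local) auto
        then show ?case
          using v_step[of z w] v_step'[of z w] by simp
      qed
    qed
    then have "((\<lambda>w. v (z + w) - v z + v z) \<longlongrightarrow> 0 + v z) (at 0)"
      by (intro tendsto_intros) (rule tendsto_mono[OF at_within_le_nhds])
    then show ?thesis
      by (simp add: isCont_iff)
  qed
  then have cont: "continuous_on UNIV v"
    by (simp add: continuous_at_imp_continuous_on)
  have mean: "\<exists>K. \<forall>\<^sub>F h in at_right 0. 4 * v z \<le> v (z + of_real h) + v (z - of_real h)
      + v (z + \<i> * of_real h) + v (z - \<i> * of_real h) + K * h ^ 3" for z
  proof -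
    \<comment> \<open>Modulo \<open>M\<close>, \<open>c (z + w) = s - w s\<^sup>2 + w\<^sup>2 s\<^sup>3 - w\<^sup>3 s\<^sup>3 c (z + w)\<close>; the terms of degree \<open>1\<close> and \<open>2\<close> cancel
      in the sum over \<open>w = \<plusminus>h, \<plusminus>ih\<close>.\<close>
    define s where "s = c z"
    define e where "e w = c (z + w) - (s + (- w) *\<^sub>C (s o\<^sub>L c (z + w)))" for w
    define p where "p w = c (z + w) + (w ^ 3) *\<^sub>C (s o\<^sub>L (s o\<^sub>L (s o\<^sub>L c (z + w))))" for w
    have sA: "s \<in> A" by (simp add: s_def c)
    \<comment> \<open>The resolvent identity is inserted into itself twice; the errors of the three
      uses are \<open>e w\<close> times 1, \<open>- w s\<close> and \<open>w^2 s^2\<close>, and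
      everything else telescopes.\<close>
    have taylor: "p w - (s - w *\<^sub>C (s o\<^sub>L s) + (w\<^sup>2) *\<^sub>C (s o\<^sub>L (s o\<^sub>L s))) =
        e w - w *\<^sub>C (s o\<^sub>L e w) + (w\<^sup>2) *\<^sub>C (s o\<^sub>L (s o\<^sub>L e w))" for w
      by (rule blinfun_eqI)
        (simp add: p_def e_def blinfun.bilinear_simps scaleC_blinfun.rep_eq apply_scaleC sA
          scaleC_scaleC scaleC_add_right complex_vector.scale_right_diff_distrib
          power2_eq_square power3_eq_cube mult.assoc algebra_simps)
    have "e w \<in> M" for w
      unfolding e_def s_def by (rule step)
    then have pM: "p w - (s - w *\<^sub>C (s o\<^sub>L s) + (w\<^sup>2) *\<^sub>C (s o\<^sub>L (s o\<^sub>L s))) \<in> M" for w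
      unfolding taylor
      by (intro complex_vector.subspace_add[OF M(2)] complex_vector.subspace_diff[OF M(2)]
          complex_vector.subspace_scale[OF M(2)] M(3) sA)
    \<comment> \<open>\<open>v_local\<close> replaces \<open>v (z + w)\<close> in the cubic
      remainder by \<open>2 * v z\<close>, so the constant does not depend on \<open>w\<close>; four
      such remainders produce the 8 below.\<close>
    have qp: "q (p w) \<le> v (z + w) + 2 * norm s ^ 3 * v z * cmod w ^ 3"
      if "cmod w * norm s \<le> 1/2" for w
    proof -
      have "q (s o\<^sub>L (s o\<^sub>L (s o\<^sub>L c (z + w)))) \<le> norm s * (norm s * (norm s * v (z + w)))"
        unfolding v_def by (intro order.trans[OF q_comp] mult_left_mono order.refl sA) auto
      also have "\<dots> \<le> norm s * (norm s * (norm s * (2 * v z)))"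
        using that by (intro mult_left_mono v_local) (auto simp: s_def)
      finally have "cmod w ^ 3 * q (s o\<^sub>L (s o\<^sub>L (s o\<^sub>L c (z + w)))) \<le>
          cmod w ^ 3 * (norm s * (norm s * (norm s * (2 * v z))))"
        by (rule mult_left_mono) simp
      then show ?thesis
        using q_add[of "c (z + w)" "(w ^ 3) *\<^sub>C (s o\<^sub>L (s o\<^sub>L (s o\<^sub>L c (z + w))))"]
        by (simp add: p_def v_def q_scale norm_mult power3_eq_cube algebra_simps)
    qed
    have "\<forall>\<^sub>F h in at_right 0. cmod (of_real h) * norm s < 1/2"
    proof -
      have "((\<lambda>h. cmod (of_real h) * norm s) \<longlongrightarrow> cmod (of_real 0) * norm s) (at_right 0)"
        by (intro tendsto_intros)
      then show ?thesis by (intro order_tendstoD(2)) auto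
    qed
    moreover have "\<forall>\<^sub>F h in at_right (0::real). h > 0"
      by (simp add: eventually_at_right_less)
    ultimately have "\<forall>\<^sub>F h in at_right 0. 4 * v z \<le> v (z + of_real h) + v (z - of_real h)
      + v (z + \<i> * of_real h) + v (z - \<i> * of_real h) + (8 * norm s ^ 3 * v z) * h ^ 3"
    proof eventually_elim
      case (elim h)
      define H where "H = complex_of_real h"
      let ?t = "\<lambda>w. s - w *\<^sub>C (s o\<^sub>L s) + (w\<^sup>2) *\<^sub>C (s o\<^sub>L (s o\<^sub>L s))"
      have "(p H + p (- H) + p (\<i> * H) + p (- \<i> * H)) - 4 *\<^sub>C s =
          (p H - ?t H) + (p (- H) - ?t (- H)) + (p (\<i> * H) - ?t (\<i> * H)) + (p (- \<i> * H) - ?t (- \<i> * H))"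
      proof -
        have "?t H + ?t (- H) + ?t (\<i> * H) + ?t (- \<i> * H) = 4 *\<^sub>C s"
          using scaleC_add_left[of 2 2 s] scaleC_add_left[of 1 1 s]
          by (simp add: power_mult_distrib algebra_simps)
        then show ?thesis by (simp add: algebra_simps)
      qed
      also have "\<dots> \<in> M"
        by (intro complex_vector.subspace_add[OF M(2)] pM)
      finally have "q (4 *\<^sub>C s) = q (p H + p (- H) + p (\<i> * H) + p (- \<i> * H))"
        by (intro q_cong[symmetric])
      then have "4 * v z = q (p H + p (- H) + p (\<i> * H) + p (- \<i> * H))"
        by (simp add: q_scale v_def s_def)
      also have "\<dots> \<le> q (p H) + q (p (- H)) + q (p (\<i> * H)) + q (p (- \<i> * H))"
        by (intro order.trans[OF q_add] add_right_mono order.refl)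
      finally show ?case
        using qp[of H] qp[of "- H"] qp[of "\<i> * H"] qp[of "- \<i> * H"] elim
        by (simp add: H_def norm_mult)
    qed
    then show ?thesis by blast
  qed
  have "(v \<longlongrightarrow> 0) at_infinity"
  proof (rule Lim_null_comparison)
    show "((\<lambda>z. q id_blinfun / (cmod z - norm b)) \<longlongrightarrow> 0) at_infinity"
      by (intro tendsto_divide_0[OF tendsto_const] filterlim_at_top_imp_at_infinity
          filterlim_tendsto_add_at_top[of "\<lambda>_. - norm b", simplified add.commute, simplified]
          filterlim_norm_at_top) auto
    show "\<forall>\<^sub>F z in at_infinity. norm (v z) \<le> q id_blinfun / (cmod z - norm b)"
      using filterlim_at_top_dense[THEN iffD1, OF filterlim_norm_at_top, rule_format, of "norm b"]
    proof eventually_elim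
      case (elim z)
      \<comment> \<open>Modulo \<open>M\<close>, \<open>z c(z)\<close> is the identity plus
        \<open>b c(z)\<close>; solving the resulting inequality for \<open>v z\<close> gives decay
        at infinity.\<close>
      have "z *\<^sub>C c z - (id_blinfun + (b o\<^sub>L c z)) = ((z *\<^sub>C id_blinfun - b) o\<^sub>L c z) - id_blinfun"
        by (rule blinfun_eqI) (simp add: blinfun.bilinear_simps scaleC_blinfun.rep_eq algebra_simps)
      then have "q (z *\<^sub>C c z) = q (id_blinfun + (b o\<^sub>L c z))"
        using inv[of z] by (intro q_cong) (simp only:)
      then have "cmod z * v z \<le> q id_blinfun + norm b * v z"
        using q_add[of id_blinfun "b o\<^sub>L c z"] q_comp[OF b, of "c z"] by (simp add: v_def q_scale)
      then show ?case
        using elim q_nonneg by (simp add: v_def field_simps)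
    qed
  qed
  with cont mean have "v 0 \<le> 0"
    by (rule submean_vanishing_at_infinity_nonpos)
  \<comment> \<open>The resolvent at 0 thus vanishes modulo the closed ideal \<open>M\<close>,
    although its product with \<open>- b\<close> is the identity modulo \<open>M\<close>. This puts
    the identity into \<open>M\<close>.\<close>
  then have "infdist (c 0) M = 0"
    using q_nonneg[of "c 0"] by (simp add: v_def q_def)
  then have "c 0 \<in> M"
    using in_closed_iff_infdist_zero[OF \<open>closed M\<close> ne] by blast
  then have "(0 *\<^sub>C id_blinfun - b) o\<^sub>L c 0 \<in> M"
    by (intro M(3) diff_mem scale_mem id_mem b)
  then have "((0 *\<^sub>C id_blinfun - b) o\<^sub>L c 0) - (((0 *\<^sub>C id_blinfun - b) o\<^sub>L c 0) - id_blinfun) \<in> M"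
    using inv[of 0] by (rule complex_vector.subspace_diff[OF M(2)])
  moreover have "S - (S - T) = T" for S T :: "'a \<Rightarrow>\<^sub>L 'a"
    by simp
  ultimately show False
    using \<open>id_blinfun \<notin> M\<close> by (simp only:)
qed

section \<open>Maximal ideals are closed and have codimension one\<close>

lemma ideal_closure:
  assumes "ideal J (operator_ring A)"
  shows "ideal (closure J) (operator_ring A)"
proof -
  have J: "J \<subseteq> A" "complex_vector.subspace J" "\<And>S T. S \<in> A \<Longrightarrow> T \<in> J \<Longrightarrow> S o\<^sub>L T \<in> J"
    using assms by (auto simp: ideal_iff)
  have "complex_vector.subspace (closure J)"
    unfolding complex_vector.subspace_def
  proof (intro conjI ballI allI)
    show "0 \<in> closure J"
      using complex_vector.subspace_0[OF J(2)] closure_subset by blast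
    show "S + T \<in> closure J" if ST: "S \<in> closure J" "T \<in> closure J" for S T
    proof -
      obtain s t where "\<And>n. s n \<in> J" "s \<longlonglongrightarrow> S" "\<And>n. t n \<in> J" "t \<longlonglongrightarrow> T"
        using ST unfolding closure_sequential by blast
      then show ?thesis
        unfolding closure_sequential using complex_vector.subspace_add[OF J(2)]
        by (intro exI[of _ "\<lambda>n. s n + t n"]) (auto intro: tendsto_add)
    qed
    have "scaleC z ` closure J \<subseteq> closure J" for z
      using complex_vector.subspace_scale[OF J(2)] closure_subset
      by (intro image_closure_subset linear_continuous_on[OF bounded_linear_scaleC_right]) auto
    then show "z *\<^sub>C S \<in> closure J" if "S \<in> closure J" for z S
      using that by blast
  qed
  moreover have "S o\<^sub>L T \<in> closure J" if "S \<in> A" "T \<in> closure J" for S T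
  proof -
    have "(\<lambda>T. S o\<^sub>L T) ` closure J \<subseteq> closure J"
      using J(3)[OF \<open>S \<in> A\<close>] closure_subset
      by (intro image_closure_subset continuous_intros) auto
    then show ?thesis
      using that by blast
  qed
  moreover have "closure J \<subseteq> A"
    using J(1) closed by (rule closure_minimal)
  ultimately show ?thesis
    by (simp add: ideal_iff)
qed

lemma maximalideal_id_notin:
  assumes "maximalideal M (operator_ring A)"
  shows "id_blinfun \<notin> M"
proof
  interpret maximalideal M "operator_ring A" by fact
  have M: "M \<subseteq> A" "\<And>S T. S \<in> A \<Longrightarrow> T \<in> M \<Longrightarrow> S o\<^sub>L T \<in> M"
    using is_ideal by (auto simp: ideal_iff)
  assume "id_blinfun \<in> M"
  then have "S \<in> M" if "S \<in> A" for S
    using M(2)[OF that] by (metis blinfun_compose_id_right)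
  with M(1) I_notcarr show False
    by (auto simp: operator_ring_def)
qed

text \<open>If \<open>m \<in> M\<close> is at distance less than \<open>1\<close> from the identity, then the fixed point \<open>s\<close> of
  \<open>s \<mapsto> id + (id - m) s\<close> is an inverse of \<open>m\<close> in \<open>A\<close>.\<close>

lemma maximalideal_closed:
  assumes "maximalideal M (operator_ring A)"
  shows "closed M"
proof -
  interpret maximalideal M "operator_ring A" by fact
  have M: "M \<subseteq> A" "complex_vector.subspace M" "\<And>S T. S \<in> A \<Longrightarrow> T \<in> M \<Longrightarrow> S o\<^sub>L T \<in> M"
    using is_ideal by (auto simp: ideal_iff)
  have cl: "ideal (closure M) (operator_ring A)"
    using is_ideal by (rule ideal_closure)
  then have "closure M \<subseteq> A"
    by (simp add: ideal_iff)
  then have "closure M = M \<or> closure M = A"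
    using I_maximal[OF cl closure_subset] by (simp add: operator_ring_def)
  moreover have "closure M \<noteq> A"
  proof
    assume "closure M = A"
    then obtain m where m: "m \<in> M" "dist m id_blinfun < 1"
      using id_mem closure_approachable[of id_blinfun M] by (metis zero_less_one)
    define t where "t = id_blinfun - m"
    have t: "t \<in> A" "norm t < 1"
      using m M id_mem diff_mem by (auto simp: t_def dist_norm norm_minus_commute)
    have "\<exists>!s\<in>A. id_blinfun + (t o\<^sub>L s) = s"
    proof (rule Banach_fix[of A "norm t"])
      show "complete A"
        using closed by (simp add: complete_eq_closed)
      show "dist (id_blinfun + (t o\<^sub>L S)) (id_blinfun + (t o\<^sub>L T)) \<le> norm t * dist S T" for S T
        using norm_blinfun_compose[of t "S - T"]
        by (simp add: dist_norm bounded_bilinear.diff_right[OF bounded_bilinear_blinfun_compose])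
    qed (use t id_mem add_mem comp_mem in auto)
    then obtain s where s: "s \<in> A" "id_blinfun + (t o\<^sub>L s) = s"
      by blast
    have "(t o\<^sub>L s) = s - (m o\<^sub>L s)"
      by (rule blinfun_eqI) (simp add: t_def blinfun.bilinear_simps)
    with s(2) have "m o\<^sub>L s = id_blinfun"
      by (simp add: algebra_simps)
    moreover have "m o\<^sub>L s = s o\<^sub>L m"
      using M(1) s(1) m(1) by (intro comp_commute) auto
    ultimately have "id_blinfun \<in> M"
      using M(3)[OF s(1) m(1)] by simp
    then show False
      using maximalideal_id_notin[OF assms] by blast
  qed
  ultimately show ?thesis
    using closed_closure[of M] by simp
qed

text \<open>The ideal \<open>M + a A\<close> is strictly larger than \<open>M\<close>, so it is all
  of \<open>A\<close> and contains the identity.\<close>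

lemma invertible_mod_maximalideal:
  assumes "maximalideal M (operator_ring A)" and a: "a \<in> A" "a \<notin> M"
  obtains c where "c \<in> A" "(a o\<^sub>L c) - id_blinfun \<in> M"
proof -
  interpret maximalideal M "operator_ring A" by fact
  have M: "M \<subseteq> A" "complex_vector.subspace M" "\<And>S T. S \<in> A \<Longrightarrow> T \<in> M \<Longrightarrow> S o\<^sub>L T \<in> M"
    using is_ideal by (auto simp: ideal_iff)
  define J where "J = {m + (a o\<^sub>L c) | m c. m \<in> M \<and> c \<in> A}"
  have J_I: "S \<in> J" if "S = m + (a o\<^sub>L c)" "m \<in> M" "c \<in> A" for S m c
    using that by (auto simp: J_def)
  have "ideal J (operator_ring A)"
    unfolding ideal_iff complex_vector.subspace_def
  proof (intro conjI ballI allI)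
    show "J \<subseteq> A"
      using M(1) a add_mem comp_mem by (auto simp: J_def)
    show "0 \<in> J"
      using complex_vector.subspace_0[OF M(2)] complex_vector.subspace_0[OF subspace]
      by (intro J_I[of _ 0 0]) auto
  next
    fix S T assume "S \<in> J" "T \<in> J"
    then obtain m c n d where "S = m + (a o\<^sub>L c)" "T = n + (a o\<^sub>L d)"
      "m \<in> M" "c \<in> A" "n \<in> M" "d \<in> A"
      by (auto simp: J_def)
    then show "S + T \<in> J"
      using complex_vector.subspace_add[OF M(2)] add_mem
      by (intro J_I[of _ "m + n" "c + d"])
        (auto simp: bounded_bilinear.add_right[OF bounded_bilinear_blinfun_compose])
  next
    fix z S assume "S \<in> J"
    then obtain m c where "S = m + (a o\<^sub>L c)" "m \<in> M" "c \<in> A"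
      by (auto simp: J_def)
    then show "z *\<^sub>C S \<in> J"
      using complex_vector.subspace_scale[OF M(2)] scale_mem a apply_scaleC
      by (intro J_I[of _ "z *\<^sub>C m" "z *\<^sub>C c"])
        (auto intro!: blinfun_eqI simp: scaleC_blinfun.rep_eq blinfun.bilinear_simps scaleC_add_right)
  next
    fix S T assume S: "S \<in> A" and "T \<in> J"
    then obtain m c where "T = m + (a o\<^sub>L c)" "m \<in> M" "c \<in> A"
      by (auto simp: J_def)
    then show "S o\<^sub>L T \<in> J"
      using M(3) S comp_mem apply_commute[OF S a(1)]
      by (intro J_I[of _ "S o\<^sub>L m" "S o\<^sub>L c"])
        (auto intro!: blinfun_eqI simp: blinfun.bilinear_simps)
  qed
  moreover have "M \<subseteq> J"
    using complex_vector.subspace_0[OF subspace] by (auto intro!: J_I[of _ _ 0])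
  moreover have "a \<in> J"
    using complex_vector.subspace_0[OF M(2)] id_mem by (intro J_I[of _ 0 id_blinfun]) (auto simp: blinfun_compose_id_right)
  moreover from calculation have "J \<subseteq> A"
    by (simp add: ideal_iff)
  ultimately have "J = A"
    using I_maximal[of J] a by (auto simp: operator_ring_def)
  then have "id_blinfun \<in> J"
    using id_mem by simp
  then obtain m c where mc: "id_blinfun = m + (a o\<^sub>L c)" "m \<in> M" "c \<in> A"
    unfolding J_def by blast
  then have "(a o\<^sub>L c) - id_blinfun = - m"
    by (simp add: algebra_simps)
  with mc show ?thesis
    using complex_vector.subspace_neg[OF M(2)] by (intro that[of c]) auto
qed

text \<open>Some \<open>z - b\<close> is not invertible modulo \<open>M\<close>; as every element
  outside \<open>M\<close> is invertible modulo \<open>M\<close>, it must lie in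
  \<open>M\<close>.\<close>

lemma maximalideal_codim_one:
  assumes M: "maximalideal M (operator_ring A)" and b: "b \<in> A"
  obtains z where "z *\<^sub>C id_blinfun - b \<in> M"
proof -
  obtain z where z: "\<And>c. c \<in> A \<Longrightarrow> ((z *\<^sub>C id_blinfun - b) o\<^sub>L c) - id_blinfun \<notin> M"
    using exists_not_invertible_mod_ideal[OF maximalideal.axioms(1)[OF M]
        maximalideal_closed[OF M] maximalideal_id_notin[OF M] b] by blast
  have "z *\<^sub>C id_blinfun - b \<in> A"
    by (intro diff_mem scale_mem id_mem b)
  with z show ?thesis
    using invertible_mod_maximalideal[OF M] that by blast
qed

section \<open>Annihilators, and orbits of ideals as invariant subspaces\<close>

lemma ideal_annihilator: "ideal {T \<in> A. T x = 0} (operator_ring A)"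
  unfolding ideal_iff complex_vector.subspace_def
  using complex_vector.subspace_0[OF subspace]
  by (auto simp: blinfun.add_left scaleC_blinfun.rep_eq intro: add_mem scale_mem comp_mem)

text \<open>Evaluation at \<open>x\<close> is continuous. Closedness is what allows spectral
  synthesis to be applied to the annihilator.\<close>

lemma closed_annihilator: "closed {T \<in> A. T x = 0}"
proof -
  have "closed ((\<lambda>T. blinfun_apply T x) -` {0})"
    by (intro closed_vimage continuous_intros)
  then have "closed (A \<inter> (\<lambda>T. blinfun_apply T x) -` {0})"
    using closed by (rule closed_Int[rotated])
  also have "A \<inter> (\<lambda>T. blinfun_apply T x) -` {0} = {T \<in> A. T x = 0}"
    by auto
  finally show ?thesis .
qed

lemma ideal_orbit_mem_Lat:
  assumes J: "ideal J (operator_ring A)" and "closed ((\<lambda>T. blinfun_apply T x) ` J)"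
  shows "(\<lambda>T. blinfun_apply T x) ` J \<in> Lat A"
proof -
  have J': "J \<subseteq> A" "complex_vector.subspace J" "\<And>S T. S \<in> A \<Longrightarrow> T \<in> J \<Longrightarrow> S o\<^sub>L T \<in> J"
    using J by (auto simp: ideal_iff)
  have I: "y \<in> (\<lambda>T. blinfun_apply T x) ` J" if "y = blinfun_apply T x" "T \<in> J" for y T
    using that by blast
  have "complex_vector.subspace ((\<lambda>T. blinfun_apply T x) ` J)"
    unfolding complex_vector.subspace_def
  proof (intro conjI ballI allI)
    show "0 \<in> (\<lambda>T. blinfun_apply T x) ` J"
      using complex_vector.subspace_0[OF J'(2)] by (intro I[of _ 0]) auto
  next
    fix y z assume "y \<in> (\<lambda>T. blinfun_apply T x) ` J" "z \<in> (\<lambda>T. blinfun_apply T x) ` J"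
    then obtain S T where "y = blinfun_apply S x" "z = blinfun_apply T x" "S \<in> J" "T \<in> J" by blast
    then show "y + z \<in> (\<lambda>T. blinfun_apply T x) ` J"
      using complex_vector.subspace_add[OF J'(2)]
      by (intro I[of _ "S + T"]) (auto simp: blinfun.add_left)
  next
    fix c y assume "y \<in> (\<lambda>T. blinfun_apply T x) ` J"
    then obtain T where "y = blinfun_apply T x" "T \<in> J" by blast
    then show "c *\<^sub>C y \<in> (\<lambda>T. blinfun_apply T x) ` J"
      using complex_vector.subspace_scale[OF J'(2)]
      by (intro I[of _ "c *\<^sub>C T"]) (auto simp: scaleC_blinfun.rep_eq)
  qed
  moreover have "T ` (\<lambda>T. blinfun_apply T x) ` J \<subseteq> (\<lambda>T. blinfun_apply T x) ` J" if "T \<in> A" for T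
    using J'(3)[OF that] by (auto intro!: I[of _ "_ o\<^sub>L _"])
  ultimately show ?thesis
    using assms(2) by (simp add: Lat_def)
qed

lemma orbit_eq: "orbit A x = (\<lambda>T. blinfun_apply T x) ` A"
  by (auto simp: orbit_def)

lemma orbit_mem_Lat:
  assumes "closed (orbit A x)"
  shows "orbit A x \<in> Lat A"
proof -
  have "ideal A (operator_ring A)"
    unfolding ideal_iff using subspace comp_mem by blast
  then show ?thesis
    using assms unfolding orbit_eq by (rule ideal_orbit_mem_Lat)
qed

section \<open>Reflexivity\<close>

text \<open>Bounded preimages lift a convergent sequence in the orbit to a convergent sequence in
  \<open>A\<close>. Since \<open>J\<close> contains the annihilator of \<open>x\<close>, membership
  in \<open>J\<close> depends only on the value at \<open>x\<close>, so the lifted sequence stays in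
  \<open>J\<close>.\<close>

lemma closed_ideal_orbit:
  assumes J: "ideal J (operator_ring A)" "closed J" and ann: "{T \<in> A. T x = 0} \<subseteq> J"
    and x: "closed (orbit A x)" "\<And>y. y \<in> orbit A x \<Longrightarrow> \<exists>T\<in>A. blinfun_apply T x = y \<and> norm T \<le> C * norm y"
  shows "closed ((\<lambda>T. blinfun_apply T x) ` J)"
  unfolding closed_sequential_limits
proof (intro allI impI, elim conjE)
  fix f l assume f: "\<forall>n. f n \<in> (\<lambda>T. blinfun_apply T x) ` J" "f \<longlonglongrightarrow> l"
  have J': "J \<subseteq> A" "complex_vector.subspace J"
    using J(1) by (auto simp: ideal_iff)
  have orb: "complex_vector.subspace (orbit A x)"
    using orbit_mem_Lat[OF x(1)] by (simp add: Lat_def)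
  from f(1) obtain m where m: "\<And>n. m n \<in> J" "\<And>n. f n = blinfun_apply (m n) x"
    unfolding image_iff by metis
  have fn: "f n \<in> orbit A x" for n
    using m[of n] J' by (auto simp: orbit_def)
  then have "l \<in> orbit A x"
    using x(1) f(2) closed_sequentially by blast
  then obtain b where b: "b \<in> A" "blinfun_apply b x = l"
    by (auto simp: orbit_def)
  have "f n - l \<in> orbit A x" for n
    using fn \<open>l \<in> orbit A x\<close> by (rule complex_vector.subspace_diff[OF orb])
  then have "\<forall>n. \<exists>T. T \<in> A \<and> blinfun_apply T x = f n - l \<and> norm T \<le> C * norm (f n - l)"
    using x(2) by blast
  from choice[OF this] obtain d where d: "\<And>n. d n \<in> A" "\<And>n. blinfun_apply (d n) x = f n - l"
    "\<And>n. norm (d n) \<le> C * norm (f n - l)"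
    by blast
  have "(\<lambda>n. C * norm (f n - l)) \<longlonglongrightarrow> C * norm (l - l)"
    using f(2) by (intro tendsto_intros)
  then have null: "(\<lambda>n. C * norm (f n - l)) \<longlonglongrightarrow> 0"
    by simp
  have "d \<longlonglongrightarrow> 0"
    by (rule Lim_null_comparison[OF _ null]) (simp add: d(3))
  then have lim: "(\<lambda>n. b + d n) \<longlonglongrightarrow> b + 0"
    by (intro tendsto_intros)
  \<comment> \<open>Both \<open>m n\<close> and \<open>b + d n\<close> send \<open>x\<close> to
    \<open>f n\<close>, so their difference annihilates \<open>x\<close>.\<close>
  have "m n - (b + d n) \<in> J" for n
    using m(1)[of n] J' b d m(2)[of n]
    by (intro subsetD[OF ann]) (auto intro!: diff_mem add_mem simp: blinfun.bilinear_simps)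
  then have "m n - (m n - (b + d n)) \<in> J" for n
    using m(1)[of n] by (rule complex_vector.subspace_diff[OF J'(2), rotated])
  then have "b + d n \<in> J" for n
    by (simp add: add.commute)
  then have "b + 0 \<in> J"
    by (rule closed_sequentially[OF J(2) _ lim])
  then have "b \<in> J"
    by simp
  then show "l \<in> (\<lambda>T. blinfun_apply T x) ` J"
    using b(2) by blast
qed

text \<open>Writing \<open>S y = g x\<close>, the element \<open>g\<close> is shown to lie in every
  maximal ideal above the annihilator of \<open>x\<close>; by synthesis it then lies in the
  annihilator itself.\<close>

lemma algLat_vanishes_on_orbit:
  assumes S: "S \<in> algLat A" "S x = 0" and syn: "spectral_synthesis A"
    and x: "closed (orbit A x)" "\<And>y. y \<in> orbit A x \<Longrightarrow> \<exists>T\<in>A. blinfun_apply T x = y \<and> norm T \<le> C * norm y"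
    and y: "y \<in> orbit A x"
  shows "S y = 0"
proof -
  let ?N = "{T \<in> A. T x = 0}"
  have S_lin: "S (u - w) = S u - S w" "S (z *\<^sub>C u) = z *\<^sub>C S u" for u w z
    using S(1) by (auto simp: algLat_def bounded_operators_def Vector_Spaces.linear_iff blinfun.diff_right)
  have S_Lat: "S u \<in> K" if "K \<in> Lat A" "u \<in> K" for u K
    using S(1) that by (auto simp: algLat_def)
  obtain b where b: "b \<in> A" "y = blinfun_apply b x"
    using y by (auto simp: orbit_def)
  obtain g where g: "g \<in> A" "S y = blinfun_apply g x"
    using S_Lat[OF orbit_mem_Lat[OF x(1)] y] by (auto simp: orbit_def)
  have "g \<in> M" if M: "maximalideal M (operator_ring A)" and NM: "?N \<subseteq> M" for M
  proof -
    have idM: "ideal M (operator_ring A)"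
      using M by (rule maximalideal.axioms)
    then have M': "M \<subseteq> A" "complex_vector.subspace M"
      by (auto simp: ideal_iff)
    let ?Mx = "(\<lambda>T. blinfun_apply T x) ` M"
    have Lat: "?Mx \<in> Lat A"
      using closed_ideal_orbit[OF idM maximalideal_closed[OF M] NM x]
      by (rule ideal_orbit_mem_Lat[OF idM])
    \<comment> \<open>Modulo \<open>M\<close>, \<open>b\<close> is the scalar \<open>z\<close>, so
      \<open>y - z x\<close> lies in the invariant subspace \<open>M x\<close>; as \<open>S\<close>
      kills \<open>x\<close>, it sends \<open>y\<close> and \<open>y - z x\<close> to the same
      vector.\<close>
    obtain z where z: "z *\<^sub>C id_blinfun - b \<in> M"
      using maximalideal_codim_one[OF M b(1)] .
    have "S ((b - z *\<^sub>C id_blinfun) x) \<in> ?Mx"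
      using complex_vector.subspace_neg[OF M'(2) z] by (intro S_Lat[OF Lat]) simp
    moreover have "(b - z *\<^sub>C id_blinfun) x = y - z *\<^sub>C x"
      by (simp add: b blinfun.diff_left scaleC_blinfun.rep_eq)
    ultimately have "S y \<in> ?Mx"
      by (simp add: S_lin S(2))
    then obtain m where m: "m \<in> M" "g x = blinfun_apply m x"
      using g by auto
    \<comment> \<open>\<open>g - m\<close> annihilates \<open>x\<close>, and \<open>M\<close>
      contains the annihilator.\<close>
    then have "g - m \<in> M"
      using NM g M' by (auto simp: blinfun.diff_left intro!: diff_mem)
    then have "(g - m) + m \<in> M"
      using m(1) by (rule complex_vector.subspace_add[OF M'(2)])
    then show ?thesis by simp
  qed
  moreover have "?N = A \<inter> \<Inter>{M. maximalideal M (operator_ring A) \<and> ?N \<subseteq> M}"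
    using syn ideal_annihilator closed_annihilator unfolding spectral_synthesis_def by blast
  ultimately have "g \<in> ?N"
    using g(1) by blast
  then show ?thesis
    using g by simp
qed

lemma algebra_le_algLat: "A \<subseteq> algLat A"
  using unital by (auto simp: algLat_def Lat_def unital_subalgebra_def image_subset_iff)

lemma reflexive_if_split_strict_multiplicity_two:
  assumes syn: "spectral_synthesis A" and "split_strict_multiplicity_two A"
  shows "reflexive A"
proof -
  obtain x y where x: "closed (orbit A x)" and y: "closed (orbit A y)"
    and sum: "direct_sum_decomposition (orbit A x) (orbit A y)"
    using assms(2) by (auto simp: split_strict_multiplicity_two_def)
  have xL: "orbit A x \<in> Lat A" and yL: "orbit A y \<in> Lat A"
    using x y by (simp_all add: orbit_mem_Lat)
  then have xs: "complex_vector.subspace (orbit A x)" and ys: "complex_vector.subspace (orbit A y)"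
    by (simp_all add: Lat_def)
  have inter: "orbit A x \<inter> orbit A y = {0}"
    using sum by (simp add: direct_sum_decomposition_def)
  have decomp: "\<exists>S T. S \<in> A \<and> T \<in> A \<and> u = blinfun_apply S x + blinfun_apply T y" for u
  proof -
    have "u \<in> {v + w | v w. v \<in> orbit A x \<and> w \<in> orbit A y}"
      using sum by (simp add: direct_sum_decomposition_def)
    then show ?thesis by (auto simp: orbit_def)
  qed
  have direct: "v = v' \<and> w = w'" if "v + w = v' + w'" "v \<in> orbit A x" "v' \<in> orbit A x"
    "w \<in> orbit A y" "w' \<in> orbit A y" for v w v' w'
  proof -
    have "v - v' = w' - w"
      using that(1) by (simp add: algebra_simps)
    then have "v - v' \<in> orbit A x \<inter> orbit A y" "w' - w \<in> orbit A x \<inter> orbit A y"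
      using complex_vector.subspace_diff[OF xs that(2,3)] complex_vector.subspace_diff[OF ys that(5,4)]
      by auto
    then show ?thesis
      by (simp add: inter)
  qed
  have orb: "T x \<in> orbit A x" "T y \<in> orbit A y" if "T \<in> A" for T
    using that by (auto simp: orbit_def)
  \<comment> \<open>The open mapping lemma and \<open>complete_isometric_image\<close> are
    formulated for real subspaces.\<close>
  have real_subspace: "Real_Vector_Spaces.subspace A"
    using subspace scale_mem[of _ "complex_of_real _"]
    by (auto simp: Real_Vector_Spaces.subspace_def complex_vector.subspace_def scaleC_of_real)

  \<comment> \<open>Open mapping for the surjection of \<open>A \<times> A\<close> onto the whole
    space sending \<open>(S, T)\<close> to \<open>S x + T y\<close>: every vector has coefficients
    of controlled norm.\<close>
  obtain C where "C > 0" and "\<And>u. \<exists>p\<in>A \<times> A. blinfun_apply (fst p) x + blinfun_apply (snd p) y = u \<and> norm p \<le> C * norm u"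
  proof (rule bounded_linear_surj_bounded_preimage)
    show "bounded_linear (\<lambda>p. blinfun_apply (fst p) x + blinfun_apply (snd p) y)"
      by (intro bounded_linear_add
          bounded_linear_compose[OF blinfun.bounded_linear_left]
          bounded_linear_fst bounded_linear_snd)
    show "Real_Vector_Spaces.subspace (A \<times> A)"
      using real_subspace real_subspace by (rule subspace_Times)
    show "closed (A \<times> A)"
      using closed by (intro closed_Times)
    show "(\<lambda>p. blinfun_apply (fst p) x + blinfun_apply (snd p) y) ` (A \<times> A) = UNIV"
      using decomp by (force simp: image_iff)
  qed blast
  then have C: "C > 0" "\<exists>S\<in>A. \<exists>T\<in>A. blinfun_apply S x + blinfun_apply T y = u \<and> norm S \<le> C * norm u \<and> norm T \<le> C * norm u" for u
    by (auto, metis (no_types) fst_conv snd_conv norm_fst_le norm_snd_le order.trans)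
  have bound_x: "\<exists>T\<in>A. blinfun_apply T x = u \<and> norm T \<le> C * norm u" if u: "u \<in> orbit A x" for u
  proof -
    obtain S T where ST: "S \<in> A" "T \<in> A" "blinfun_apply S x + blinfun_apply T y = u" "norm S \<le> C * norm u"
      using C(2) by blast
    then show ?thesis
      using direct[of "S x" "T y" u 0] orb u complex_vector.subspace_0[OF ys] by auto
  qed
  have bound_y: "\<exists>T\<in>A. blinfun_apply T y = u \<and> norm T \<le> C * norm u" if u: "u \<in> orbit A y" for u
  proof -
    obtain S T where ST: "S \<in> A" "T \<in> A" "blinfun_apply S x + blinfun_apply T y = u" "norm T \<le> C * norm u"
      using C(2) by blast
    then show ?thesis
      using direct[of "S x" "T y" 0 u] orb u complex_vector.subspace_0[OF xs] by auto
  qed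

  define D where "D = C * (C * norm x + C * norm y)"
  have D: "D \<ge> 0"
    using C(1) by (simp add: D_def)
  \<comment> \<open>The bound \<open>C\<close> enters twice: for \<open>T (x + y)\<close>, where
    directness identifies the two components as \<open>T x\<close> and \<open>T y\<close>, and for
    an arbitrary \<open>u = S x + R y\<close>, where commutativity gives
    \<open>T u = S (T x) + R (T y)\<close>.\<close>
  have T_le: "norm T \<le> D * norm (T (x + y))" if T: "T \<in> A" for T
  proof (rule norm_blinfun_bound)
    obtain P Q where PQ: "P \<in> A" "Q \<in> A" "blinfun_apply P x + blinfun_apply Q y = T (x + y)"
      "norm P \<le> C * norm (T (x + y))" "norm Q \<le> C * norm (T (x + y))"
      using C(2) by blast
    then have "P x = T x" "Q y = T y"
      using direct[of "P x" "Q y" "T x" "T y"] orb T by (auto simp: blinfun.add_right)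
    then have "norm (T x) \<le> C * norm (T (x + y)) * norm x" "norm (T y) \<le> C * norm (T (x + y)) * norm y"
      using PQ by (metis mult_right_mono norm_blinfun norm_ge_zero order.trans)+
    then have "norm (T x) + norm (T y) \<le>
        C * norm (T (x + y)) * norm x + C * norm (T (x + y)) * norm y"
      by (rule add_mono)
    also have "\<dots> = (C * norm x + C * norm y) * norm (T (x + y))"
      by (simp only: distrib_left distrib_right mult_ac)
    finally have Txy: "norm (T x) + norm (T y) \<le> (C * norm x + C * norm y) * norm (T (x + y))" .
    fix u
    obtain S R where SR: "S \<in> A" "R \<in> A" "blinfun_apply S x + blinfun_apply R y = u" "norm S \<le> C * norm u" "norm R \<le> C * norm u"
      using C(2) by blast
    have "T u = S (T x) + R (T y)"
      using apply_commute[OF T SR(1), of x] apply_commute[OF T SR(2), of y] SR(3)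
      by (auto simp: blinfun.add_right)
    then have "norm (T u) \<le> norm S * norm (T x) + norm R * norm (T y)"
      by (simp only:) (intro norm_triangle_mono norm_blinfun)
    also have "\<dots> \<le> C * norm u * norm (T x) + C * norm u * norm (T y)"
      using SR by (intro add_mono mult_right_mono) auto
    also have "\<dots> = C * norm u * (norm (T x) + norm (T y))"
      by (simp add: distrib_left)
    also have "\<dots> \<le> C * norm u * ((C * norm x + C * norm y) * norm (T (x + y)))"
      using Txy C(1) by (intro mult_left_mono) auto
    finally show "norm (T u) \<le> D * norm (T (x + y)) * norm u"
      by (simp add: D_def mult_ac)
  qed (use D in auto)
  have "complete ((\<lambda>T. blinfun_apply T (x + y)) ` A)"
  proof (rule complete_isometric_image)
    \<comment> \<open>\<open>D\<close> may be 0, for instance when \<open>x = y = 0\<close>; hence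
      \<open>D + 1\<close>.\<close>
    show "0 < 1 / (D + 1)"
      using D by simp
    show "\<forall>T\<in>A. 1 / (D + 1) * norm T \<le> norm (blinfun_apply T (x + y))"
    proof
      fix T assume "T \<in> A"
      then have "norm T \<le> (D + 1) * norm (T (x + y))"
        using T_le[of T] by (simp add: distrib_right add_increasing2)
      then show "1 / (D + 1) * norm T \<le> norm (blinfun_apply T (x + y))"
        using D by (simp add: field_simps)
    qed
    show "bounded_linear (\<lambda>T. blinfun_apply T (x + y))"
      by (rule blinfun.bounded_linear_left)
    show "complete A"
      using closed by (simp add: complete_eq_closed)
  qed (rule real_subspace)
  then have xyL: "orbit A (x + y) \<in> Lat A"
    by (intro orbit_mem_Lat) (simp add: orbit_eq complete_eq_closed)

  have "T \<in> A" if T: "T \<in> algLat A" for T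
  proof -
    have "x + y \<in> orbit A (x + y)" "x \<in> orbit A x" "y \<in> orbit A y"
      using id_mem by (force simp: orbit_def)+
    then have Txy: "T (x + y) \<in> orbit A (x + y)" "T x \<in> orbit A x" "T y \<in> orbit A y"
      using T xL yL xyL by (auto simp: algLat_def)
    then obtain a where a: "a \<in> A" "T (x + y) = blinfun_apply a (x + y)"
      by (auto simp: orbit_def)
    then have Ta: "T x = a x" "T y = a y"
      using direct[of "T x" "T y" "a x" "a y"] Txy orb by (auto simp: blinfun.add_right)
    have S: "T - a \<in> algLat A"
      unfolding algLat_def
    proof (intro CollectI conjI ballI)
      have "T \<in> bounded_operators" "a \<in> bounded_operators"
        using T a(1) unital by (auto simp: algLat_def unital_subalgebra_def)
      then show "T - a \<in> bounded_operators"
        by (auto simp: bounded_operators_def Vector_Spaces.linear_iff blinfun.bilinear_simps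
            complex_vector.scale_right_diff_distrib)
      fix K assume K: "K \<in> Lat A"
      then have "T u \<in> K" "a u \<in> K" if "u \<in> K" for u
        using that T a(1) algebra_le_algLat by (auto simp: algLat_def)
      then show "(T - a) ` K \<subseteq> K"
        using K by (auto simp: Lat_def blinfun.diff_left complex_vector.subspace_diff)
    qed
    have Sxy: "(T - a) x = 0" "(T - a) y = 0"
      using Ta by (simp_all add: blinfun.diff_left)
    have "(T - a) u = 0" for u
    proof -
      obtain P Q where PQ: "P \<in> A" "Q \<in> A" "u = blinfun_apply P x + blinfun_apply Q y"
        using decomp by blast
      have "(T - a) (P x) = 0"
        by (rule algLat_vanishes_on_orbit[OF S Sxy(1) syn x _ orb(1)[OF PQ(1)]]) (rule bound_x)
      moreover have "(T - a) (Q y) = 0"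
        by (rule algLat_vanishes_on_orbit[OF S Sxy(2) syn y _ orb(2)[OF PQ(2)]]) (rule bound_y)
      ultimately show ?thesis
        by (simp add: PQ(3) blinfun.add_right)
    qed
    then have "T = a"
      by (intro blinfun_eqI) (simp add: blinfun.diff_left)
    with a show ?thesis by simp
  qed
  then show ?thesis
    using algebra_le_algLat by (auto simp: reflexive_def)
qed

end

theorem corollary7:
  fixes A :: "('a::complex_banach \<Rightarrow>\<^sub>L 'a) set"
  assumes "unital_subalgebra A"
    and "abelian A"
    and "closed A"
    and "spectral_synthesis A"
    and "split_strict_multiplicity_two A"
  shows "reflexive A"
proof -
  interpret abelian_operator_algebra A
    using assms by unfold_locales
  show ?thesis
    using assms by (intro reflexive_if_split_strict_multiplicity_two)
qed

end
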